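(* Let $\mathcal{A}$ be an alternating $\mathsf{Val}$ automaton realizing a function $f$ (on finite or on infinite words). Then $\mathcal{A}$ is good for games if and only if $\mathcal{A}$ is good for threshold games.
   Context: **Games.** Let $\Sigma$ be a finite nonempty alphabet. An arena is $(V,E,V_E,V_A,L)$ with a (possibly infinite) set $V$ of positions partitioned into Eve's positions $V_E$ and Adam's positions $V_A$, an initial position, edges $E\subseteq V\times V$ and labels $L:E\to\Sigma\cup\{\varepsilon\}$. In infinite-duration games every position has an outgoing edge. A play is a maximal path from the initial position; its non-$\varepsilon$ labels form a word. An $f$ game is an arena with payoff function $f$ (with $f:\Sigma^*\to\mathbb{R}$ or $f:\Sigma^\omega\to\mathbb{R}$; plays are assumed to induce words in the domain of $f$); the payoff of a play is the $f$-value of its word. Strategies map partial plays ending in a position of the respective player to an outgoing edge. The value of an Eve strategy is the infimum of payoffs over plays agreeing with it, and the value of an Adam strategy is the supremum. The game is determined if (sup over Eve strategies of their values) $=$ (inf over Adam strategies of their values); this number is the value of the game. Eve wins the $t$-threshold game on $G$ if the value of $G$ is at least $t$; otherwise Adam wins it. Standing assumption: all games considered (including product games) are determined. **Automata.** An alternating quantitative automaton is $\mathcal{A}=(\Sigma,Q,\iota,\delta)$ with finite nonempty state set $Q$, initial state $\iota\in Q$, and $\delta:Q\times\Sigma\to \mathsf{B}^+(\mathbb{Q}\times Q)$, where $\mathsf{B}^+(\mathbb{Q}\times Q)$ is the set of positive Boolean formulas over (rational weight, state) pairs; it is total (each $\delta(q,a)$ contains at least one pair). A $\mathsf{Val}$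 automaton is one equipped with a value function $\mathsf{Val}:\mathbb{Q}^*\to\mathbb{R}$ (finite words) or $\mathsf{Val}:\mathbb{Q}^\omega\to\mathbb{R}$ (infinite words). For a word $w$, the game $G(\mathcal{A},w)$ is played letter by letter from $\iota$: in state $q$ with next letter $a$, Eve resolves the disjunctions and Adam the conjunctions of $\delta(q,a)$ until a pair $(x,q')$ is reached; weight $x$ is output and the state becomes $q'$. The payoff is $\mathsf{Val}$ of the output weight sequence. The value $\mathcal{A}(w)$ is the value of this game; $\mathcal{A}$ realizes the function $w\mapsto\mathcal{A}(w)$ if this game is determined for all $w$. Only automata realizing functions are considered. **Product.** For a $\Sigma$-labelled game $G$ and an automaton $\mathcal{A}$ over $\Sigma$, the product game $G\times\mathcal{A}$ starts in (initial position of $G$, $\iota$). From $(v,q)$ the owner of $v$ in $G$ picks an edge $(v,v')$; if it is labelled $\varepsilon$ the game moves to $(v',q)$; if it is labelled $a\in\Sigma$, then Eve resolves the disjunctions and Adam the conjunctions of $\delta(q,a)$ until a pair $(x,q')$ is reached, weight $x$ is output, and the game moves to $(v',q')$. The payoff is $\mathsf{Val}$ of the output weight sequence. **Good for gameness.** Let $\mathcal{A}$ realize $f$. $\mathcal{A}$ is good for games if for every determined game $G$ with a $\Sigma$-labelled arena and payoff function $f$, $G$ and $G\times\mathcal{A}$ have the same value. For $t\in\mathbb{R}$, $\mathcal{A}$ is good for $t$-threshold games if for every such $G$, Eve wins the $t$-threshold game on $G$ if and only if she wins the $t$-threshold game on $G\times\mathcal{A}$. $\mathcal{A}$ is good for threshold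 games if it is good for $t$-threshold games for all $t\in\mathbb{R}$. *)

theory Defs
  imports "HOL-Library.Extended_Real" "HOL-Library.Infinite_Set"
begin

text \<open>Used both for words and for plays (sequences of positions).\<close>

datatype 'a word = Fin "'a list" | Inf "nat \<Rightarrow> 'a"

text \<open>A payoff (or value) function is defined either on all finite words or on all infinite words.\<close>

datatype 'a payoff_fun =
    is_finitary: On_finite "'a list \<Rightarrow> real"
  | On_infinite "(nat \<Rightarrow> 'a) \<Rightarrow> real"

fun in_domain :: "'a payoff_fun \<Rightarrow> 'a word \<Rightarrow> bool" where
  "in_domain (On_finite f) (Fin u) = True"
| "in_domain (On_infinite f) (Inf u) = True"
| "in_domain _ _ = False"

fun payoff :: "'a payoff_fun \<Rightarrow> 'a word \<Rightarrow> real" where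
  "payoff (On_finite f) (Fin u) = f u"
| "payoff (On_infinite f) (Inf u) = f u"
| "payoff _ _ = undefined"

text \<open>The label \<open>None\<close> stands for the silent label \<open>\<epsilon>\<close>; labels of non-edges are irrelevant.\<close>

record ('v, 'a) arena =
  positions :: "'v set"
  eve :: "'v set"
  adam :: "'v set"
  initial :: 'v
  edges :: "('v \<times> 'v) set"
  label :: "'v \<times> 'v \<Rightarrow> 'a option"

definition wf_arena :: "('v, 'a) arena \<Rightarrow> bool" where
  "wf_arena G \<longleftrightarrow>
     eve G \<union> adam G = positions G \<and> eve G \<inter> adam G = {} \<and>
     initial G \<in> positions G \<and> edges G \<subseteq> positions G \<times> positions G"

definition partial_play :: "('v, 'a) arena \<Rightarrow> 'v list \<Rightarrow> bool" where
  "partial_play G p \<longleftrightarrow>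
     p \<noteq> [] \<and> hd p = initial G \<and> successively (\<lambda>u v. (u, v) \<in> edges G) p"

fun play :: "('v, 'a) arena \<Rightarrow> 'v word \<Rightarrow> bool" where
  "play G (Fin p) \<longleftrightarrow> partial_play G p \<and> (\<forall>v. (last p, v) \<notin> edges G)"
| "play G (Inf p) \<longleftrightarrow> p 0 = initial G \<and> (\<forall>i. (p i, p (Suc i)) \<in> edges G)"

text \<open>The word of a play lists its non-\<open>\<epsilon>\<close> labels in order; an infinite play with only finitely
  many of them induces a finite word.\<close>

definition inf_play_word :: "(nat \<Rightarrow> 'a option) \<Rightarrow> 'a word" where
  "inf_play_word l =
     (let N = {i. l i \<noteq> None} in
      if finite N then Fin (map (\<lambda>i. the (l i)) (sorted_list_of_set N))
      else Inf (\<lambda>k. the (l (enumerate N k))))"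

fun play_word :: "('v, 'a) arena \<Rightarrow> 'v word \<Rightarrow> 'a word" where
  "play_word G (Fin p) = Fin (List.map_filter (label G) (zip p (tl p)))"
| "play_word G (Inf p) = inf_play_word (\<lambda>i. label G (p i, p (Suc i)))"

text \<open>Payoffs on infinite words give infinite-duration games, which have no dead ends.\<close>

definition is_game :: "'a payoff_fun \<Rightarrow> ('v, 'a) arena \<Rightarrow> bool" where
  "is_game f G \<longleftrightarrow>
     wf_arena G \<and>
     (\<not> is_finitary f \<longrightarrow> (\<forall>v\<in>positions G. \<exists>v'. (v, v') \<in> edges G)) \<and>
     (\<forall>p. play G p \<longrightarrow> in_domain f (play_word G p))"

text \<open>A strategy of the player owning \<open>X\<close> maps a partial play to the target of the chosen edge.
  Only its results on partial plays that end in \<open>X\<close> and can be continued matter.\<close>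

definition strategy :: "('v, 'a) arena \<Rightarrow> 'v set \<Rightarrow> ('v list \<Rightarrow> 'v) \<Rightarrow> bool" where
  "strategy G X \<sigma> \<longleftrightarrow>
     (\<forall>h. partial_play G h \<and> last h \<in> X \<and> last h \<in> Domain (edges G) \<longrightarrow> (last h, \<sigma> h) \<in> edges G)"

fun agrees :: "'v set \<Rightarrow> ('v list \<Rightarrow> 'v) \<Rightarrow> 'v word \<Rightarrow> bool" where
  "agrees X \<sigma> (Fin p) \<longleftrightarrow>
     (\<forall>i. Suc i < length p \<and> p ! i \<in> X \<longrightarrow> p ! Suc i = \<sigma> (take (Suc i) p))"
| "agrees X \<sigma> (Inf p) \<longleftrightarrow> (\<forall>i. p i \<in> X \<longrightarrow> p (Suc i) = \<sigma> (map p [0..<Suc i]))"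

definition play_payoff :: "'a payoff_fun \<Rightarrow> ('v, 'a) arena \<Rightarrow> 'v word \<Rightarrow> ereal" where
  "play_payoff f G p = ereal (payoff f (play_word G p))"

definition eve_strategy_value :: "'a payoff_fun \<Rightarrow> ('v, 'a) arena \<Rightarrow> ('v list \<Rightarrow> 'v) \<Rightarrow> ereal" where
  "eve_strategy_value f G \<sigma> = (INF p\<in>{p. play G p \<and> agrees (eve G) \<sigma> p}. play_payoff f G p)"

definition adam_strategy_value :: "'a payoff_fun \<Rightarrow> ('v, 'a) arena \<Rightarrow> ('v list \<Rightarrow> 'v) \<Rightarrow> ereal" where
  "adam_strategy_value f G \<sigma> = (SUP p\<in>{p. play G p \<and> agrees (adam G) \<sigma> p}. play_payoff f G p)"

definition eve_value :: "'a payoff_fun \<Rightarrow> ('v, 'a) arena \<Rightarrow> ereal" where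
  "eve_value f G = (SUP \<sigma>\<in>{\<sigma>. strategy G (eve G) \<sigma>}. eve_strategy_value f G \<sigma>)"

definition adam_value :: "'a payoff_fun \<Rightarrow> ('v, 'a) arena \<Rightarrow> ereal" where
  "adam_value f G = (INF \<sigma>\<in>{\<sigma>. strategy G (adam G) \<sigma>}. adam_strategy_value f G \<sigma>)"

definition determined :: "'a payoff_fun \<Rightarrow> ('v, 'a) arena \<Rightarrow> bool" where
  "determined f G \<longleftrightarrow> eve_value f G = adam_value f G"

text \<open>Only meaningful for determined games. The value may be infinite if payoffs are unbounded.\<close>

definition game_value :: "'a payoff_fun \<Rightarrow> ('v, 'a) arena \<Rightarrow> ereal" where
  "game_value f G = (if determined f G then eve_value f G else undefined)"

definition eve_wins_threshold :: "real \<Rightarrow> 'a payoff_fun \<Rightarrow> ('v, 'a) arena \<Rightarrow> bool" where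
  "eve_wins_threshold t f G \<longleftrightarrow> ereal t \<le> game_value f G"

text \<open>There are no constants true and false, so every formula contains at least one atom and
  transition functions are total.\<close>

datatype 'x pos_bool = Atom 'x | Conj "'x pos_bool" "'x pos_bool" | Disj "'x pos_bool" "'x pos_bool"

text \<open>The alphabet and the state set are the types \<open>'a\<close> and \<open>'q\<close>, to be taken in class \<open>finite\<close>.\<close>

record ('a, 'q) automaton =
  init_state :: 'q
  delta :: "'q \<Rightarrow> 'a \<Rightarrow> (rat \<times> 'q) pos_bool"
  val_fun :: "rat payoff_fun"

text \<open>Besides \<open>(v, State q)\<close>, the product has positions \<open>(v, Formula \<phi>)\<close> in which the formula
  \<open>\<phi>\<close> remains to be resolved before the game continues from \<open>v\<close>. A weight is output on the
  only edge leaving an atom, so the owner of atoms is irrelevant.\<close>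

datatype 'q stage = State 'q | Formula "(rat \<times> 'q) pos_bool"

inductive_set product_edges ::
    "('v, 'a) arena \<Rightarrow> ('a, 'q) automaton \<Rightarrow> (('v \<times> 'q stage) \<times> ('v \<times> 'q stage)) set"
  for G :: "('v, 'a) arena" and A :: "('a, 'q) automaton" where
  silent: "\<lbrakk>(v, v') \<in> edges G; label G (v, v') = None\<rbrakk>
    \<Longrightarrow> ((v, State q), (v', State q)) \<in> product_edges G A"
| letter: "\<lbrakk>(v, v') \<in> edges G; label G (v, v') = Some a\<rbrakk>
    \<Longrightarrow> ((v, State q), (v', Formula (delta A q a))) \<in> product_edges G A"
| conj_left: "v \<in> positions G \<Longrightarrow> ((v, Formula (Conj \<phi> \<psi>)), (v, Formula \<phi>)) \<in> product_edges G A"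
| conj_right: "v \<in> positions G \<Longrightarrow> ((v, Formula (Conj \<phi> \<psi>)), (v, Formula \<psi>)) \<in> product_edges G A"
| disj_left: "v \<in> positions G \<Longrightarrow> ((v, Formula (Disj \<phi> \<psi>)), (v, Formula \<phi>)) \<in> product_edges G A"
| disj_right: "v \<in> positions G \<Longrightarrow> ((v, Formula (Disj \<phi> \<psi>)), (v, Formula \<psi>)) \<in> product_edges G A"
| atom: "v \<in> positions G \<Longrightarrow> ((v, Formula (Atom (x, q))), (v, State q)) \<in> product_edges G A"

fun product_label :: "('v \<times> 'q stage) \<times> ('v \<times> 'q stage) \<Rightarrow> rat option" where
  "product_label ((v, Formula (Atom (x, q))), _) = Some x"
| "product_label _ = None"

fun eve_stage :: "('v, 'a) arena \<Rightarrow> 'v \<times> 'q stage \<Rightarrow> bool" where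
  "eve_stage G (v, State q) \<longleftrightarrow> v \<in> eve G"
| "eve_stage G (v, Formula (Conj _ _)) \<longleftrightarrow> False"
| "eve_stage G (v, Formula _) \<longleftrightarrow> True"

definition product :: "('v, 'a) arena \<Rightarrow> ('a, 'q) automaton \<Rightarrow> ('v \<times> 'q stage, rat) arena" where
  "product G A =
     \<lparr>positions = positions G \<times> UNIV,
      eve = {s \<in> positions G \<times> UNIV. eve_stage G s},
      adam = {s \<in> positions G \<times> UNIV. \<not> eve_stage G s},
      initial = (initial G, State (init_state A)),
      edges = product_edges G A,
      label = product_label\<rparr>"

text \<open>The arena without any choices whose only play spells the given word. Playing the automaton
  on the word letter by letter is the product with this arena: \<open>(i, State q)\<close> means that the
  first \<open>i\<close> letters have been read and the automaton is in state \<open>q\<close>.\<close>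

fun word_arena :: "'a word \<Rightarrow> (nat, 'a) arena" where
  "word_arena (Fin u) =
     \<lparr>positions = {..length u}, eve = {..length u}, adam = {}, initial = 0,
      edges = {(i, Suc i) | i. i < length u}, label = (\<lambda>(i, _). Some (u ! i))\<rparr>"
| "word_arena (Inf u) =
     \<lparr>positions = UNIV, eve = UNIV, adam = {}, initial = 0,
      edges = {(i, Suc i) | i. True}, label = (\<lambda>(i, _). Some (u i))\<rparr>"

definition word_game :: "('a, 'q) automaton \<Rightarrow> 'a word \<Rightarrow> (nat \<times> 'q stage, rat) arena" where
  "word_game A w = product (word_arena w) A"

definition realizes :: "('a, 'q) automaton \<Rightarrow> 'a payoff_fun \<Rightarrow> bool" where
  "realizes A f \<longleftrightarrow>
     (is_finitary f \<longleftrightarrow> is_finitary (val_fun A)) \<and>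
     (\<forall>w. in_domain f w \<longrightarrow>
        determined (val_fun A) (word_game A w) \<and>
        game_value (val_fun A) (word_game A w) = ereal (payoff f w))"

text \<open>The type argument is the type from which the positions of arenas are drawn, since a definition
  cannot quantify over it.\<close>

definition good_for_games :: "'v itself \<Rightarrow> ('a, 'q) automaton \<Rightarrow> 'a payoff_fun \<Rightarrow> bool" where
  "good_for_games (_ :: 'v itself) A f \<longleftrightarrow>
     (\<forall>G :: ('v, 'a) arena. is_game f G \<and> determined f G \<longrightarrow>
        game_value f G = game_value (val_fun A) (product G A))"

definition good_for_t_threshold_games ::
    "'v itself \<Rightarrow> real \<Rightarrow> ('a, 'q) automaton \<Rightarrow> 'a payoff_fun \<Rightarrow> bool" where
  "good_for_t_threshold_games (_ :: 'v itself) t A f \<longleftrightarrow>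
     (\<forall>G :: ('v, 'a) arena. is_game f G \<and> determined f G \<longrightarrow>
        (eve_wins_threshold t f G \<longleftrightarrow> eve_wins_threshold t (val_fun A) (product G A)))"

definition good_for_threshold_games :: "'v itself \<Rightarrow> ('a, 'q) automaton \<Rightarrow> 'a payoff_fun \<Rightarrow> bool" where
  "good_for_threshold_games (T :: 'v itself) A f \<longleftrightarrow>
     (\<forall>t. good_for_t_threshold_games T t A f)"

end

theory Submission
  imports Defs
begin

text \<open>An extended real, finite or not, is determined by the set of real numbers below it,
  because the reals are dense in \<open>ereal\<close>. Winning the t-threshold game means that t is
  a lower bound of the value, so agreement at all thresholds t is equality of values.\<close>

lemma ereal_le_by_real_lower_bounds:
  fixes x y :: ereal
  assumes "\<And>t. ereal t \<le> x \<Longrightarrow> ereal t \<le> y"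
  shows "x \<le> y"
proof (rule ccontr)
  assume "\<not> x \<le> y"
  \<comment> \<open>By density, a real separates the two values: a lower bound of \<open>x\<close>
    but not of \<open>y\<close>.\<close>
  then obtain t where "y < ereal t" "ereal t < x"
    using ereal_dense2[of y x] by (auto simp: not_le)
  with assms[of t] show False
    by (metis less_imp_le not_le)
qed

lemma ereal_eq_iff_real_lower_bounds:
  fixes x y :: ereal
  shows "x = y \<longleftrightarrow> (\<forall>t. ereal t \<le> x \<longleftrightarrow> ereal t \<le> y)"
  by (metis antisym ereal_le_by_real_lower_bounds)

theorem lemma5:
  fixes A :: "('a::finite, 'q::finite) automaton" and f :: "'a payoff_fun"
  assumes "realizes A f"
    and products_determined: "\<And>G :: ('v, 'a) arena.
      is_game f G \<Longrightarrow> determined f G \<Longrightarrow> determined (val_fun A) (product G A)"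
  shows "good_for_games TYPE('v) A f \<longleftrightarrow> good_for_threshold_games TYPE('v) A f"
  unfolding good_for_games_def good_for_threshold_games_def good_for_t_threshold_games_def
    eve_wins_threshold_def ereal_eq_iff_real_lower_bounds
  \<comment> \<open>The two sides now differ only in the order of the quantifiers over games and
    thresholds.\<close>
  by blast

end
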